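(* Let $n\in\mathbb{N}$. Then $$t(1,1,9,9;n)=\begin{cases}\dfrac83\sigma(2n+5) & \text{if } n\equiv0\pmod3,\\[2pt] 16\sigma\!\left(\dfrac{2n+5}{9}\right) & \text{if } n\equiv2\pmod 9,\\[2pt] 0 & \text{if } n\equiv5,8\pmod 9,\\[2pt] \dfrac83\big(\sigma(2n+5)-c(2n+5)\big) & \text{if } n\equiv1\pmod 3.\end{cases}$$
   Context: $\mathbb{N}$ denotes the set of positive integers. For $a,b,c,d\in\mathbb{N}$ and an integer $m\ge0$, $t(a,b,c,d;m)$ is the number of $(x,y,z,w)\in\mathbb{Z}^4$ with $m = a\frac{x(x-1)}{2}+b\frac{y(y-1)}{2}+c\frac{z(z-1)}{2}+d\frac{w(w-1)}{2}$. $\sigma(m)$ is the sum of the positive divisors of $m$. The integers $c(m)$ ($m\ge1$) are defined by the power series identity $q\prod_{k=1}^\infty(1-q^{6k})^4=\sum_{m=1}^\infty c(m)q^m$ ($|q|<1$); equivalently $c(m)=\frac13\sum(-1)^a a$, summed over $(a,b)\in\mathbb{Z}^2$ with $4m=a^2+3b^2$, $a\equiv2\pmod3$, $b\equiv a+2\pmod 4$. *)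

theory Defs
  imports "HOL-Analysis.Analysis"
begin

text \<open>
  Since \<open>x * (x - 1)\<close> is always even, the integer divisions are exact. For positive
  \<open>a, b, c, d\<close> the set is finite (lemma \<open>finite_tri_reps\<close>), so \<open>card\<close>
  is the actual number of representations.
\<close>
definition tri_reps :: "nat \<Rightarrow> nat \<Rightarrow> nat \<Rightarrow> nat \<Rightarrow> nat \<Rightarrow> (int \<times> int \<times> int \<times> int) set" where
  "tri_reps a b c d m =
     {(x, y, z, w). int m = int a * (x * (x - 1) div 2) + int b * (y * (y - 1) div 2)
                          + int c * (z * (z - 1) div 2) + int d * (w * (w - 1) div 2)}"

definition tri_count :: "nat \<Rightarrow> nat \<Rightarrow> nat \<Rightarrow> nat \<Rightarrow> nat \<Rightarrow> nat" where
  "tri_count a b c d m = card (tri_reps a b c d m)"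

definition divisor_sum :: "nat \<Rightarrow> nat" where
  "divisor_sum m = (\<Sum>k | k dvd m. k)"

text \<open>
  The coefficients of \<open>q \<Prod>\<^sub>k\<^sub>\<ge>\<^sub>1 (1 - q\<^sup>6\<^sup>k)\<^sup>4\<close>, read as an identity of formal power
  series. The infinite product is taken in the \<open>q\<close>-adic topology of \<open>int fps\<close>, where it
  converges (lemma \<open>convergent_prod_eta\<close>); the index \<open>k\<close> is shifted to start from 0.
\<close>
definition eta_coeff :: "nat \<Rightarrow> int" where
  "eta_coeff m = fps_nth (fps_X * (\<Prod>k. (1 - fps_X ^ (6 * Suc k)) ^ 4)) m"

lemma tri_nonneg: "0 \<le> x * (x - 1) div (2 :: int)"
proof -
  have "0 \<le> x * (x - 1)"
    by (cases "x \<ge> 1") (auto intro: mult_nonneg_nonneg mult_nonpos_nonpos)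
  thus ?thesis by simp
qed

lemma tri_le_imp:
  fixes x :: int
  assumes "x * (x - 1) div 2 \<le> int m"
  shows "x \<in> {- int (2 * m + 2)..int (2 * m + 2)}"
proof (rule ccontr)
  assume neg: "x \<notin> {- int (2 * m + 2)..int (2 * m + 2)}"
  have le: "x * (x - 1) \<le> 2 * int m + 1" using assms by linarith
  consider "x > int (2 * m + 2)" | "x < - int (2 * m + 2)" using neg by fastforce
  thus False
  proof cases
    case 1
    hence "int (2 * m + 2) * 1 \<le> x * (x - 1)" by (intro mult_mono) auto
    with le show False by simp
  next
    case 2
    hence "int (2 * m + 2) * 1 \<le> (- x) * (1 - x)" by (intro mult_mono) auto
    also have "\<dots> = x * (x - 1)" by (simp add: algebra_simps)
    finally show False using le by simp
  qed
qed

lemma finite_tri_reps: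
  assumes "a > 0" "b > 0" "c > 0" "d > 0"
  shows "finite (tri_reps a b c d m)"
proof (rule finite_subset)
  let ?I = "{- int (2 * m + 2)..int (2 * m + 2)}"
  show "tri_reps a b c d m \<subseteq> ?I \<times> ?I \<times> ?I \<times> ?I"
  proof
    fix p assume "p \<in> tri_reps a b c d m"
    then obtain x y z w where p: "p = (x, y, z, w)" and
      eq: "int m = int a * (x * (x - 1) div 2) + int b * (y * (y - 1) div 2)
                 + int c * (z * (z - 1) div 2) + int d * (w * (w - 1) div 2)"
      by (auto simp: tri_reps_def)
    have ge: "u * (u - 1) div 2 \<le> int e * (u * (u - 1) div 2)" if "e > 0" for e :: nat and u :: int
      using mult_right_mono[of 1 "int e" "u * (u - 1) div 2"] tri_nonneg[of u] that by simp
    have nn: "0 \<le> u * (u - 1) div 2" for u :: int by (rule tri_nonneg)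
    show "p \<in> ?I \<times> ?I \<times> ?I \<times> ?I"
      unfolding p mem_Times_iff fst_conv snd_conv
      using eq ge[OF assms(1), of x] ge[OF assms(2), of y] ge[OF assms(3), of z]
        ge[OF assms(4), of w] nn[of x] nn[of y] nn[of z] nn[of w]
      by (intro conjI tri_le_imp; linarith)
  qed
qed auto

lemma convergent_prod_eta:
  "convergent_prod (\<lambda>k. (1 - fps_X ^ (6 * Suc k)) ^ 4 :: int fps)"
proof -
  let ?f = "\<lambda>k. (1 - fps_X ^ (6 * Suc k)) ^ 4 :: int fps"
  have nz0: "fps_nth (?f k) 0 = 1" for k
    by (simp add: fps_nth_power_0 power_0_left)
  have nz: "?f k \<noteq> 0" for k
    using nz0[of k] by (metis fps_zero_nth zero_neq_one)
  have sd: "subdegree (?f k - 1) > n" if "k > n" for n k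
  proof -
    define y :: "int fps" where "y = fps_X ^ (6 * Suc k)"
    have eq: "?f k - 1 = y * (- 4 + 6 * y - 4 * y ^ 2 + y ^ 3)"
      unfolding y_def[symmetric] by (simp add: algebra_simps eval_nat_numeral)
    have "fps_nth (- 4 + 6 * y - 4 * y ^ 2 + y ^ 3) 0 = - 4"
      by (simp add: y_def fps_nth_power_0 power_0_left)
    hence "- 4 + 6 * y - 4 * y ^ 2 + y ^ 3 \<noteq> 0" by (metis fps_zero_nth zero_neq_neg_numeral)
    moreover have "y \<noteq> 0" by (simp add: y_def)
    ultimately have "subdegree (?f k - 1) \<ge> subdegree y"
      unfolding eq by simp
    thus ?thesis using that by (simp add: y_def)
  qed
  obtain P where P: "(\<lambda>n. \<Prod>k\<le>n. ?f k) \<longlonglongrightarrow> P"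
    using tendsto_prod_fps[of ?f "\<lambda>n. n", OF nz sd] by blast
  from P have "\<forall>\<^sub>F n in sequentially. fps_nth (\<Prod>k\<le>n. ?f k) 0 = fps_nth P 0"
    unfolding tendsto_fps_iff by blast
  moreover have "fps_nth (\<Prod>k\<le>n. ?f k) 0 = 1" for n
    by (induction n) (simp_all add: fps_nth_power_0 power_0_left)
  ultimately have "P \<noteq> 0" by (auto simp: eventually_at_top_linorder)
  with P show ?thesis
    unfolding convergent_prod_def raw_has_prod_def by (intro exI[of _ 0] exI[of _ P]) simp
qed

end

theory Submission
  imports Defs
begin

text \<open>
  Completing squares, \<open>t(1,1,9,9;n)\<close> counts the representations \<open>4 m = x\<^sup>2 + y\<^sup>2 + z\<^sup>2 + w\<^sup>2\<close>
  with \<open>m = 2 n + 5\<close>, all variables odd and \<open>3\<close> dividing \<open>z\<close> and \<open>w\<close>. All four-odd-squares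
  representations together number \<open>16 \<sigma>(m)\<close>: the theta series \<open>\<theta>\<close> of the odd squares satisfies
  \<open>\<theta> (\<theta>\<^sup>4)' = 4 \<theta>' \<theta>\<^sup>4\<close>, and the resulting recurrence also holds for \<open>\<sigma>\<close> by an involution on
  \<open>{(d, x, e). x\<^sup>2 + 4 d e = N}\<close>.

  Write \<open>\<theta> = 2 E + B\<close> with \<open>E\<close> over \<open>x \<equiv> 1\<close> and \<open>B\<close> over \<open>x \<equiv> 3\<close> modulo \<open>6\<close>. Exponents modulo \<open>3\<close>
  single out the terms of \<open>\<theta>\<^sup>4\<close> and \<open>\<theta>\<^sup>2 B\<^sup>2\<close> that reach \<open>q\<^bsup>4m\<^esup>\<close>: only \<open>E\<^sup>2 B\<^sup>2\<close> if
  \<open>m \<equiv> 2\<close>, only \<open>B\<^sup>4\<close> if \<open>m \<equiv> 0\<close> (for \<open>\<theta>\<^sup>2 B\<^sup>2\<close>), and \<open>E\<^sup>4\<close> and \<open>E B\<^sup>3\<close> if \<open>m \<equiv> 1\<close>. In the last case let \<open>P\<close>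
  and \<open>Q\<close> count the representations in \<open>E\<^sup>4\<close> with \<open>x + y + z + w\<close> congruent to \<open>0\<close> and \<open>2\<close>
  modulo \<open>4\<close>. Euler's pentagonal number theorem gives \<open>c(m) = P - Q\<close>, and half of a Hadamard matrix,
  which is orthogonal, maps the representations counted by \<open>Q\<close> onto half of those in \<open>E B\<^sup>3\<close>; so the coefficient
  of \<open>E B\<^sup>3\<close> is \<open>2 Q\<close>, whence \<open>\<sigma>(m) = P + 2 Q\<close> and \<open>t = 8 Q\<close>.
\<close>

subsection \<open>Theta series\<close>

text \<open>A sum over an infinite fibre of \<open>q\<close> is 0 by default, so the product rules
  below assume that all fibres are finite.\<close>

definition gen_fps :: "('a \<Rightarrow> nat) \<Rightarrow> ('a \<Rightarrow> int) \<Rightarrow> int fps" where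
  "gen_fps q f = Abs_fps (\<lambda>n. \<Sum>p | q p = n. f p)"

lemma finite_fibres_prod:
  fixes q :: "'a \<Rightarrow> nat" and r :: "'b \<Rightarrow> nat"
  assumes "\<And>n. finite {p. q p = n}" "\<And>n. finite {p. r p = n}"
  shows "finite {p. (case p of (x, y) \<Rightarrow> q x + r y) = n}"
proof (rule finite_subset)
  show "{p. (case p of (x, y) \<Rightarrow> q x + r y) = n}
      \<subseteq> (\<Union>i\<le>n. {p. q p = i}) \<times> (\<Union>i\<le>n. {p. r p = i})" by auto
qed (use assms in auto)

text \<open>Grouping the pairs by the value \<open>i\<close> of \<open>q\<close> at the first
  component turns each group into a product of two fibres, which is the Cauchy product.\<close>

lemma gen_fps_mult:
  assumes "\<And>n. finite {p. q p = n}" "\<And>n. finite {p. r p = n}"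
  shows "gen_fps q f * gen_fps r g
       = gen_fps (\<lambda>(x, y). q x + r y) (\<lambda>(x, y). f x * g y)"
proof (rule fps_ext)
  fix n
  let ?S = "{p. (case p of (x, y) \<Rightarrow> q x + r y) = n}"
  have "(\<Sum>p\<in>?S. case p of (x, y) \<Rightarrow> f x * g y)
      = (\<Sum>i\<in>{0..n}. \<Sum>p | p \<in> ?S \<and> q (fst p) = i. case p of (x, y) \<Rightarrow> f x * g y)"
    by (intro sum.group[symmetric] finite_fibres_prod assms) auto
  also have "\<dots> = (\<Sum>i\<in>{0..n}. (\<Sum>p | q p = i. f p) * (\<Sum>p | r p = n - i. g p))"
  proof (intro sum.cong refl)
    fix i assume "i \<in> {0..n}"
    then have "{p. p \<in> ?S \<and> q (fst p) = i} = {p. q p = i} \<times> {p. r p = n - i}" by auto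
    then show "(\<Sum>p | p \<in> ?S \<and> q (fst p) = i. case p of (x, y) \<Rightarrow> f x * g y)
        = (\<Sum>p | q p = i. f p) * (\<Sum>p | r p = n - i. g p)"
      by (simp add: sum_product sum.cartesian_product)
  qed
  finally show "fps_nth (gen_fps q f * gen_fps r g) n
      = fps_nth (gen_fps (\<lambda>(x, y). q x + r y) (\<lambda>(x, y). f x * g y)) n"
    by (simp add: gen_fps_def fps_mult_nth)
qed

lemma gen_fps_mult4:
  fixes f g h k :: "'a \<Rightarrow> int"
  assumes "\<And>n. finite {p. q p = n}"
  shows "fps_nth (gen_fps q f * gen_fps q g * gen_fps q h * gen_fps q k) n
       = (\<Sum>(x, y, z, w) | q x + q y + q z + q w = n. f x * g y * h z * k w)"
proof -
  have "{p. (case p of (x, y, z, w) \<Rightarrow> q x + (q y + (q z + q w))) = n}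
      = {(x, y, z, w). q x + q y + q z + q w = n}" by auto
  then show ?thesis
    unfolding mult.assoc
    by (simp add: gen_fps_mult finite_fibres_prod assms)
       (auto simp: gen_fps_def case_prod_unfold intro!: sum.cong)
qed

lemma gen_fps_add: "gen_fps q f + gen_fps q g = gen_fps q (\<lambda>x. f x + g x)"
  by (rule fps_ext) (simp add: gen_fps_def sum.distrib)

text \<open>The exponents are the squares themselves, so that their residues modulo 3 and 8 can be
  exploited; \<open>nat\<close> loses nothing on squares.\<close>

definition theta :: "int set \<Rightarrow> int fps" where
  "theta S = gen_fps (\<lambda>x. nat (x\<^sup>2)) (indicator S)"

lemma abs_le_power2: "\<bar>x\<bar> \<le> x\<^sup>2" for x :: int
  using mult_left_mono[of 1 "\<bar>x\<bar>" "\<bar>x\<bar>"] by (cases "x = 0") (auto simp: power2_eq_square)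

lemma finite_sqrts: "finite {x::int. nat (x\<^sup>2) = n}"
proof (rule finite_subset)
  show "{x::int. nat (x\<^sup>2) = n} \<subseteq> {-int n..int n}"
  proof
    fix x :: int assume "x \<in> {x. nat (x\<^sup>2) = n}"
    then have "x\<^sup>2 = int n" by auto
    moreover have "\<bar>x\<bar> \<le> x\<^sup>2" by (rule abs_le_power2)
    ultimately show "x \<in> {-int n..int n}" by auto
  qed
qed auto

lemma theta_mult4:
  "fps_nth (theta A * theta B * theta C * theta D) n
   = int (card {(x, y, z, w). x \<in> A \<and> y \<in> B \<and> z \<in> C \<and> w \<in> D \<and> x\<^sup>2 + y\<^sup>2 + z\<^sup>2 + w\<^sup>2 = int n})"
proof -
  let ?S = "{(x, y, z, w). nat (x\<^sup>2) + nat (y\<^sup>2) + nat (z\<^sup>2) + nat (w\<^sup>2) = n} :: (int \<times> int \<times> int \<times> int) set"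
  have fin: "finite ?S"
  proof (rule finite_subset)
    let ?U = "\<Union>i\<le>n. {x::int. nat (x\<^sup>2) = i}"
    show "?S \<subseteq> ?U \<times> ?U \<times> ?U \<times> ?U" by auto
  qed (auto intro!: finite_sqrts)
  have eq: "nat (x\<^sup>2) + nat (y\<^sup>2) + nat (z\<^sup>2) + nat (w\<^sup>2) = n \<longleftrightarrow> x\<^sup>2 + y\<^sup>2 + z\<^sup>2 + w\<^sup>2 = int n"
    for x y z w :: int
    using zero_le_power2[of x] zero_le_power2[of y] zero_le_power2[of z] zero_le_power2[of w]
    by linarith
  have "fps_nth (theta A * theta B * theta C * theta D) n = (\<Sum>p\<in>?S. if p \<in> A \<times> B \<times> C \<times> D then 1 else 0)"
    unfolding theta_def
    by (subst gen_fps_mult4[OF finite_sqrts]) (auto intro!: sum.cong simp: indicator_def)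
  also have "\<dots> = int (card (?S \<inter> (A \<times> B \<times> C \<times> D)))"
    using fin by (simp add: sum.inter_restrict[symmetric])
  also have "?S \<inter> (A \<times> B \<times> C \<times> D)
    = {(x, y, z, w). x \<in> A \<and> y \<in> B \<and> z \<in> C \<and> w \<in> D \<and> x\<^sup>2 + y\<^sup>2 + z\<^sup>2 + w\<^sup>2 = int n}"
    by (auto simp: eq)
  finally show ?thesis .
qed

lemma theta_Un: "A \<inter> B = {} \<Longrightarrow> theta (A \<union> B) = theta A + theta B"
  unfolding theta_def gen_fps_add
  by (rule arg_cong[where f = "gen_fps _"]) (auto simp: indicator_def fun_eq_iff)

lemma theta_uminus: "theta (uminus ` A) = theta A"
proof (rule fps_ext)
  fix n
  show "fps_nth (theta (uminus ` A)) n = fps_nth (theta A) n"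
    unfolding theta_def gen_fps_def fps_nth_Abs_fps
    by (rule sum.reindex_bij_witness[of _ uminus uminus])
       (auto simp: indicator_def image_iff minus_equation_iff)
qed

subsection \<open>Sums of four odd squares\<close>

text \<open>A triple stands for the indefinite binary form \<open>d X^2 + x X Y - e Y^2\<close> of
  discriminant \<open>N\<close>, whose outer coefficients have opposite signs.\<close>

definition forms :: "int \<Rightarrow> (int \<times> int \<times> int) set" where
  "forms N = {(d, x, e). d > 0 \<and> e > 0 \<and> x\<^sup>2 + 4 * d * e = N}"

lemma finite_forms: "finite (forms N)"
proof (rule finite_subset)
  show "forms N \<subseteq> {0..N} \<times> {-N..N} \<times> {0..N}"
  proof
    fix p assume "p \<in> forms N"
    then obtain d x e where p: "p = (d, x, e)" and *: "d > 0" "e > 0" "x\<^sup>2 + 4 * d * e = N"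
      by (auto simp: forms_def)
    have "d * 1 \<le> d * e" "1 * e \<le> d * e" using * by (intro mult_mono; simp)+
    moreover have "\<bar>x\<bar> \<le> x\<^sup>2" by (rule abs_le_power2)
    moreover have "x\<^sup>2 \<ge> 0" by simp
    ultimately show "p \<in> {0..N} \<times> {-N..N} \<times> {0..N}"
      using * unfolding p mem_Times_iff atLeastAtMost_iff fst_conv snd_conv by (intro conjI; linarith)
  qed
qed auto

text \<open>
  The cubic \<open>r\<close> is odd in \<open>x\<close>, so it does not change the sum. With it subtracted the summand \<open>h\<close> becomes
  antisymmetric under the involution \<open>(d, x, e) \<mapsto> (d, - x - 2 d, e - x - d)\<close> of the half
  \<open>e > d + x\<close>, while \<open>(d, x, e) \<mapsto> (e, - x, d)\<close> preserves \<open>h\<close> and swaps the two halves.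
\<close>
lemma sum_forms_eq_0:
  assumes nonsq: "\<And>y. y\<^sup>2 \<noteq> N"
  shows "(\<Sum>(d, x, e)\<in>forms N. (d * e - x\<^sup>2) * d) = 0"
proof -
  define r where "r = (\<lambda>(d, x, e). x * (d\<^sup>2 - e\<^sup>2) :: int)"
  define f where "f = (\<lambda>(d, x, e). (d * e - x\<^sup>2) * (d + e) :: int)"
  define h where "h = (\<lambda>p. f p - r p)"
  define D where "D = {(d, x, e) \<in> forms N. e > d + x}"
  define D' where "D' = {(d, x, e) \<in> forms N. e < d + x}"
  have h: "h (d, x, e) = (d * e - x\<^sup>2) * (d + e) - x * (d\<^sup>2 - e\<^sup>2)" for d x e
    by (simp add: h_def f_def r_def)
  have h1: "h (e, - x, d) = h (d, x, e)" for d x e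
    unfolding h by algebra
  have h2: "h (d, - x - 2 * d, e - x - d) = - h (d, x, e)" for d x e
    unfolding h by algebra
  have disc: "(- x - 2 * d)\<^sup>2 + 4 * d * (e - x - d) = x\<^sup>2 + 4 * d * e" for d x e :: int
    by algebra
  have "forms N = D \<union> D'"
  proof -
    \<comment> \<open>The boundary between the two halves is empty: there the discriminant would be
      the square of \<open>x + 2 * d\<close>.\<close>
    have "e \<noteq> d + x" if "(d, x, e) \<in> forms N" for d x e
    proof
      assume "e = d + x"
      with that have "(x + 2 * d)\<^sup>2 = N" by (simp add: forms_def power2_eq_square algebra_simps)
      with nonsq show False by blast
    qed
    then show ?thesis by (fastforce simp: D_def D'_def)
  qed
  moreover have fin: "finite D" "finite D'" "D \<inter> D' = {}"
    by (auto simp: D_def D'_def intro!: finite_subset[OF _ finite_forms[of N]])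
  ultimately have "sum h (forms N) = sum h D + sum h D'"
    by (simp add: sum.union_disjoint)
  also have "sum h D' = sum h D"
    by (rule sum.reindex_bij_witness[of _ "\<lambda>(d, x, e). (e, - x, d)" "\<lambda>(d, x, e). (e, - x, d)"])
       (auto simp: D_def D'_def forms_def h1 mult_ac)
  also have "sum h D = 0"
  proof -
    let ?t = "\<lambda>(d, x, e). (d, - x - 2 * d, e - x - d) :: int \<times> int \<times> int"
    have "sum h D = (\<Sum>p\<in>D. - h p)"
      by (rule sum.reindex_bij_witness[of _ ?t ?t])
         (auto simp: D_def forms_def h2 disc)
    then show ?thesis by (simp add: sum_negf)
  qed
  finally have "sum f (forms N) = sum r (forms N)" by (simp add: h_def sum_subtractf)
  also have "sum r (forms N) = 0"
  proof -
    have "sum r (forms N) = (\<Sum>p\<in>forms N. - r p)"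
      by (rule sum.reindex_bij_witness[of _ "\<lambda>(d, x, e). (d, - x, e)" "\<lambda>(d, x, e). (d, - x, e)"])
         (auto simp: forms_def r_def)
    then show ?thesis by (simp add: sum_negf)
  qed
  finally have 0: "sum f (forms N) = 0" .
  \<comment> \<open>Exchanging \<open>d\<close> and \<open>e\<close> shows that the sum of
    \<open>f\<close> is twice the wanted sum.\<close>
  let ?g = "\<lambda>(d, x, e). (d * e - x\<^sup>2) * d :: int" and ?g' = "\<lambda>(d, x, e). (d * e - x\<^sup>2) * e :: int"
  have "sum ?g' (forms N) = sum ?g (forms N)"
    by (rule sum.reindex_bij_witness[of _ "\<lambda>(d, x, e). (e, x, d)" "\<lambda>(d, x, e). (e, x, d)"])
       (auto simp: forms_def mult_ac)
  moreover have "sum f (forms N) = sum ?g (forms N) + sum ?g' (forms N)"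
    unfolding sum.distrib[symmetric] by (intro sum.cong) (auto simp: f_def algebra_simps)
  ultimately show ?thesis using 0 by simp
qed

section \<open>Recurrence for the fourth power of the theta series\<close>

lemma theta_nth: "fps_nth (theta S) n = int (card {x \<in> S. x\<^sup>2 = int n})"
proof -
  have "{x::int. nat (x\<^sup>2) = n} \<inter> S = {x \<in> S. x\<^sup>2 = int n}" by auto
  then show ?thesis
    by (simp add: theta_def gen_fps_def indicator_def sum.If_cases[OF finite_sqrts] of_bool_def Int_def conj_commute)
qed

text \<open>Comparison of coefficients in
  \<open>f * fps_XD (f ^ 4) = 4 * (fps_XD f * f ^ 4)\<close>; the weight arises as (n - i) - 4
  i.\<close>

lemma power4_recurrence:
  fixes f :: "int fps"
  shows "(\<Sum>i\<le>n. fps_nth f i * (int n - 5 * int i) * fps_nth (f ^ 4) (n - i)) = 0"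
proof -
  have "f * fps_XD (f ^ 4) = 4 * (fps_XD f * f ^ 4)"
    by (simp add: fps_XD_def fps_deriv_power' eval_nat_numeral algebra_simps)
  then have "fps_nth (f * fps_XD (f ^ 4)) n = 4 * fps_nth (fps_XD f * f ^ 4) n"
    by (simp add: numeral_fps_const)
  then have "(\<Sum>i=0..n. fps_nth f i * (int (n - i) * fps_nth (f ^ 4) (n - i)))
      - 4 * (\<Sum>i=0..n. (int i * fps_nth f i) * fps_nth (f ^ 4) (n - i)) = 0"
    by (simp add: fps_mult_nth)
  then show ?thesis
    unfolding sum_distrib_left sum_subtractf[symmetric] atLeast0AtMost
    by (subst (asm) sum.cong[OF refl]) (auto simp: of_nat_diff algebra_simps)
qed

definition odds :: "int set" where "odds = {x. odd x}"

lemma odd_square_mod_8: "x\<^sup>2 mod 8 = 1" if x: "odd x" for x :: int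
proof -
  obtain k where k: "x = 2 * k + 1" using x by (rule oddE)
  have "even (k * (k + 1))" by simp
  then obtain l where "k * (k + 1) = 2 * l" by (rule evenE)
  then have "x\<^sup>2 = 8 * l + 1" by (simp add: k power2_eq_square algebra_simps)
  then show ?thesis by simp
qed

lemma theta_odds_nth_eq_0: "fps_nth (theta odds) i = 0" if "i mod 8 \<noteq> 1"
proof -
  have "{x \<in> odds. x\<^sup>2 = int i} = {}"
  proof -
    have False if x: "odd x" "x\<^sup>2 = int i" for x
      using odd_square_mod_8[OF x(1)] \<open>i mod 8 \<noteq> 1\<close> unfolding x(2) by presburger
    then show ?thesis by (auto simp: odds_def)
  qed
  then show ?thesis by (simp only: theta_nth card.empty of_nat_0)
qed

text \<open>The support is j = 4 m with m odd, since a sum of four odd squares is 4 modulo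
  8.\<close>

definition odd_sigma :: "nat \<Rightarrow> int" where
  "odd_sigma j = (if j mod 8 = 4 then int (divisor_sum (j div 4)) else 0)"

lemma diff_mod_8: "(N - i) mod 8 = 4" if "N mod 8 = 5" "i mod 8 = 1" "i \<le> N" for N i :: nat
proof -
  define a b where "a = N div 8" and "b = i div 8"
  have "N = 8 * a + 5" "i = 8 * b + 1"
    using that div_mult_mod_eq[of N 8] div_mult_mod_eq[of i 8] by (simp_all add: a_def b_def)
  then have "N - i = 8 * (a - b) + 4" using that(3) by simp
  then show ?thesis by simp
qed

text \<open>Group \<open>forms N\<close> by \<open>x^2 = i\<close>. Then \<open>d * e = k\<close>
  with k = (N - i) / 4, the sum over \<open>d\<close> is the divisor sum of \<open>k\<close>, and 4
  (k - i) = N - 5 i. As N is 5 modulo 8 it is no square, so \<open>sum_forms_eq_0\<close>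
  applies.\<close>

lemma odd_sigma_recurrence:
  assumes N: "N mod 8 = 5"
  shows "(\<Sum>i\<le>N. fps_nth (theta odds) i * (int N - 5 * int i) * odd_sigma (N - i)) = 0"
proof -
  let ?F = "\<lambda>(d, x, e). (d * e - x\<^sup>2) * d :: int"
  let ?A = "\<lambda>i. {p \<in> forms (int N). nat ((fst (snd p))\<^sup>2) = i}"
  have oddx: "odd x" if "(d, x, e) \<in> forms (int N)" for d x e
  proof -
    have "odd (int N)" using N by presburger
    with that have "odd (x\<^sup>2 + 4 * d * e)" by (simp add: forms_def)
    then show ?thesis by simp
  qed
  have "fps_nth (theta odds) i * (int N - 5 * int i) * odd_sigma (N - i) = 4 * sum ?F (?A i)"
    if i: "i \<le> N" for i
  proof (cases "i mod 8 = 1")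
    case False
    have "nat (x\<^sup>2) \<noteq> i" if "(d, x, e) \<in> forms (int N)" for d x e
    proof
      assume "nat (x\<^sup>2) = i"
      then have "x\<^sup>2 = int i" by auto
      with odd_square_mod_8[OF oddx[OF that]] False show False by presburger
    qed
    then have "?A i = {}" by auto
    then show ?thesis by (simp only: theta_odds_nth_eq_0[OF False]) simp
  next
    case True
    define k where "k = (N - i) div 4"
    have m: "(N - i) mod 8 = 4" using N True i by (rule diff_mod_8)
    have "4 dvd (N - i) mod 8" unfolding m by simp
    then have "4 dvd N - i" by (subst (asm) dvd_mod_iff) auto
    then have Nk: "N = i + 4 * k" using i unfolding k_def by simp
    have k: "k > 0" using m Nk by (cases k) auto
    let ?T = "{x \<in> odds. x\<^sup>2 = int i} \<times> {d. d dvd k}"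
    have A: "\<exists>d x e. p = (int d, x, int e) \<and> k = d * e \<and> x\<^sup>2 = int i \<and> x \<in> odds \<and> d > 0" if p: "p \<in> ?A i" for p
    proof -
      obtain d x e where p_eq: "p = (d, x, e)" by (cases p)
      with p have *: "d > 0" "e > 0" "x\<^sup>2 + 4 * d * e = int N" "nat (x\<^sup>2) = i"
        and "(d, x, e) \<in> forms (int N)" by (auto simp: forms_def)
      then have "x\<^sup>2 = int i" "odd x" using oddx by auto
      moreover from * this(1) have "int k = d * e" by (simp add: Nk)
      then have "int k = int (nat d * nat e)" using * by simp
      then have "k = nat d * nat e" by (simp only: of_nat_eq_iff)
      ultimately show ?thesis using * p_eq
        by (intro exI[of _ "nat d"] exI[of _ x] exI[of _ "nat e"]) (auto simp: odds_def)
    qed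
    have "sum ?F (?A i) = (\<Sum>(x, d)\<in>?T. (int k - int i) * int d)"
    proof (rule sum.reindex_bij_witness[of _ "\<lambda>(x, d). (int d, x, int (k div d))" "\<lambda>(d, x, e). (x, nat d)"], goal_cases)
      case (1 p)
      from A[OF this] obtain d x e where p: "p = (int d, x, int e)" "k = d * e" "x\<^sup>2 = int i" "x \<in> odds" "d > 0"
        by blast
      show ?case unfolding p(1) using p(2-5) by simp
    next
      case (2 p)
      from A[OF this] obtain d x e where p: "p = (int d, x, int e)" "k = d * e" "x\<^sup>2 = int i" "x \<in> odds" "d > 0"
        by blast
      show ?case unfolding p(1) using p(2-5) by simp
    next
      case (3 b)
      then show ?case by auto
    next
      case (4 b)
      then obtain x d where b: "b = (x, d)" "x\<^sup>2 = int i" "d dvd k" by auto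
      from b(3) obtain e where e: "k = d * e" by (rule dvdE)
      with k have "d > 0" "e > 0" by auto
      with b(1,2) e Nk show ?case by (simp add: forms_def)
    next
      case (5 p)
      from A[OF this] obtain d x e where p: "p = (int d, x, int e)" "k = d * e" "x\<^sup>2 = int i" "x \<in> odds" "d > 0"
        by blast
      show ?case unfolding p(1) using p(2-5) by simp
    qed
    also have "\<dots> = int (card {x \<in> odds. x\<^sup>2 = int i}) * ((int k - int i) * int (divisor_sum k))"
      by (simp add: divisor_sum_def sum_distrib_left flip: sum.cartesian_product)
    finally have "sum ?F (?A i) = fps_nth (theta odds) i * ((int k - int i) * int (divisor_sum k))"
      by (simp add: theta_nth)
    moreover have "odd_sigma (N - i) = int (divisor_sum k)"
      using m by (simp add: odd_sigma_def k_def)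
    ultimately show ?thesis by (simp add: Nk algebra_simps)
  qed
  then have "(\<Sum>i\<le>N. fps_nth (theta odds) i * (int N - 5 * int i) * odd_sigma (N - i))
      = (\<Sum>i\<le>N. 4 * sum ?F (?A i))" by (intro sum.cong) auto
  also have "\<dots> = 4 * (\<Sum>i\<le>N. sum ?F (?A i))" by (simp add: sum_distrib_left)
  also have "(\<Sum>i\<le>N. sum ?F (?A i)) = sum ?F (forms (int N))"
  proof (rule sum.group)
    show "(\<lambda>p. nat ((fst (snd p))\<^sup>2)) ` forms (int N) \<subseteq> {..N}"
    proof safe
      fix d x e assume "(d, x, e) \<in> forms (int N)"
      then have "d > 0" "e > 0" "x\<^sup>2 + 4 * d * e = int N" by (auto simp: forms_def)
      then have "x\<^sup>2 \<le> int N" using mult_pos_pos[of d e] by linarith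
      then show "nat ((fst (snd (d, x, e)))\<^sup>2) \<le> N" by simp
    qed
  qed (auto intro: finite_forms)
  also have "\<dots> = 0"
  proof (rule sum_forms_eq_0)
    fix y :: int
    show "y\<^sup>2 \<noteq> int N"
    proof
      assume y: "y\<^sup>2 = int N"
      moreover have "odd (int N)" using N by presburger
      ultimately have "odd (y\<^sup>2)" by simp
      then have "odd y" by simp
      from odd_square_mod_8[OF this] N show False unfolding y by presburger
    qed
  qed
  finally show ?thesis by simp
qed

text \<open>Both sides satisfy the same recurrence and agree at j = 4; for j > 4 the recurrence
  determines the value at j from smaller ones.\<close>

lemma theta_odds_power4:
  assumes "j mod 8 = 4"
  shows "fps_nth (theta odds ^ 4) j = 16 * odd_sigma j"
  using assms
proof (induction j rule: less_induct)
  case (less j)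
  let ?a = "fps_nth (theta odds)"
  have a0: "?a 0 = 0" by (rule theta_odds_nth_eq_0) simp
  have a1: "?a 1 = 2"
  proof -
    have "{x \<in> odds. x\<^sup>2 = int 1} = {1, -1}" by (auto simp: odds_def power2_eq_1_iff)
    then show ?thesis by (simp add: theta_nth)
  qed
  show ?case
  proof (cases "j = 4")
    case True
    \<comment> \<open>Factoring out one power of q reduces the coefficient at 4 to the fourth power
      of the leading coefficient 2.\<close>
    have "theta odds = fps_X * fps_shift 1 (theta odds)"
      using a0 by (intro fps_ext) (auto simp: fps_X_mult_nth)
    then have "fps_nth (theta odds ^ 4) 4 = fps_nth (fps_X ^ 4 * fps_shift 1 (theta odds) ^ 4) 4"
      by (metis power_mult_distrib)
    also have "\<dots> = 16" using a1 by (simp add: fps_X_power_mult_nth fps_nth_power_0)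
    finally show ?thesis by (simp add: True odd_sigma_def divisor_sum_def)
  next
    case False
    \<comment> \<open>The recurrence is used at \<open>N = j + 1\<close>, because the series starts
      at exponent 1 and so \<open>g j\<close> occurs in the term \<open>i = 1\<close>.\<close>
    define N where "N = Suc j"
    define g where "g = (\<lambda>j. fps_nth (theta odds ^ 4) j - 16 * odd_sigma j)"
    have N: "N mod 8 = 5" "N > 5" using less.prems False unfolding N_def by presburger+
    have "0 = (\<Sum>i\<le>N. ?a i * (int N - 5 * int i) * fps_nth (theta odds ^ 4) (N - i))
        - 16 * (\<Sum>i\<le>N. ?a i * (int N - 5 * int i) * odd_sigma (N - i))"
      unfolding power4_recurrence odd_sigma_recurrence[OF N(1)] by simp
    also have "\<dots> = (\<Sum>i\<le>N. ?a i * (int N - 5 * int i) * g (N - i))"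
      unfolding sum_distrib_left sum_subtractf[symmetric] g_def
      by (intro sum.cong refl) (simp add: algebra_simps)
    \<comment> \<open>All other terms vanish by induction or by the support of theta; the remaining
      factor 2 (N - 5) is nonzero.\<close>
    also have "\<dots> = (\<Sum>i\<in>{1}. ?a i * (int N - 5 * int i) * g (N - i))"
    proof (rule sum.mono_neutral_right)
      show "\<forall>i\<in>{..N} - {1}. ?a i * (int N - 5 * int i) * g (N - i) = 0"
      proof
        fix i assume i: "i \<in> {..N} - {1}"
        show "?a i * (int N - 5 * int i) * g (N - i) = 0"
        proof (cases "i mod 8 = 1")
          case True
          from True i have "i > 1" "i \<le> N" by (cases i; auto)+
          then have 1: "N - i < j" unfolding N_def by simp
          have 2: "(N - i) mod 8 = 4" using N(1) True \<open>i \<le> N\<close> by (rule diff_mod_8)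
          from less.IH[OF 1 2] show ?thesis by (simp add: g_def)
        qed (simp add: theta_odds_nth_eq_0)
      qed
    qed (use N in auto)
    finally have "g j = 0" using a1 N by (simp add: N_def)
    then show ?thesis by (simp add: g_def)
  qed
qed

subsection \<open>The pentagonal number theorem\<close>

text \<open>Shanks' finite form of the theorem: modulo \<open>x ^ (n + 1)\<close> only the term \<open>s = 0\<close> survives.\<close>
definition shanks_sum :: "'a::comm_ring_1 \<Rightarrow> nat \<Rightarrow> 'a" where
  "shanks_sum x n = (\<Sum>s\<le>n. (-1) ^ s * (\<Prod>j\<in>{s<..n}. 1 - x ^ j) * x ^ (s * n + s * (s + 1) div 2))"

text \<open>Up to a telescoping difference, each summand with s at most n is the same for n and n +
  1. The boundary value \<open>u (Suc n)\<close> and the new summand s = n + 1 supply the two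
  pentagonal powers.\<close>

lemma shanks_sum_Suc:
  fixes x :: "'a::comm_ring_1"
  shows "shanks_sum x (Suc n) = shanks_sum x n
     + (-1) ^ Suc n * (x ^ (Suc n * (3 * Suc n - 1) div 2) + x ^ (Suc n * (3 * Suc n + 1) div 2))"
proof -
  define t where "t = (\<lambda>s. (-1) ^ s * (\<Prod>j\<in>{s<..n}. 1 - x ^ j) * x ^ (s * n + s * (s + 1) div 2))"
  \<comment> \<open>For s at most n this equals \<open>(1 - x ^ s) * t s\<close>; written through
    \<open>t (s - 1)\<close> it also has the right value at s = n + 1, where the product in
    \<open>t n\<close> is empty.\<close>
  define u where "u = (\<lambda>s. if s = 0 then 0 else - (x ^ (n + s) * t (s - 1)))"
  have u: "(1 - x ^ s) * t s = u s" if "s \<le> n" for s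
  proof (cases s)
    case (Suc k)
    have ins: "{k<..n} = insert s {s<..n}" using that Suc by auto
    have tri: "s * (s + 1) div 2 = k * (k + 1) div 2 + s"
      unfolding Suc by simp
    have "u s = (-1) ^ s * (1 - x ^ s) * (\<Prod>j\<in>{s<..n}. 1 - x ^ j) * (x ^ (n + s) * x ^ (k * n + k * (k + 1) div 2))"
      by (simp add: u_def t_def Suc[symmetric]) (simp add: Suc ins algebra_simps)
    also have "x ^ (n + s) * x ^ (k * n + k * (k + 1) div 2) = x ^ (s * n + s * (s + 1) div 2)"
      unfolding tri power_add[symmetric] by (simp add: Suc algebra_simps)
    finally show ?thesis by (simp add: t_def mult_ac)
  qed (simp add: u_def)
  have step: "(-1) ^ s * (\<Prod>j\<in>{s<..Suc n}. 1 - x ^ j) * x ^ (s * Suc n + s * (s + 1) div 2)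
      = t s + (u (Suc s) - u s)" if "s \<le> n" for s
  proof -
    have "{s<..Suc n} = insert (Suc n) {s<..n}" using that by auto
    then have "(-1) ^ s * (\<Prod>j\<in>{s<..Suc n}. 1 - x ^ j) * x ^ (s * Suc n + s * (s + 1) div 2)
       = (1 - x ^ Suc n) * x ^ s * t s"
      by (simp add: t_def power_add mult_ac)
    also have "\<dots> = t s - x ^ (Suc n + s) * t s - (1 - x ^ s) * t s"
      by (simp add: algebra_simps power_add)
    finally show ?thesis using that by (simp add: u) (simp add: u_def)
  qed
  have "shanks_sum x (Suc n) = (\<Sum>s\<le>n. t s + (u (Suc s) - u s))
      + (-1) ^ Suc n * x ^ (Suc n * Suc n + Suc n * (Suc n + 1) div 2)"
    unfolding shanks_sum_def sum.atMost_Suc by (intro arg_cong2[where f = "(+)"] sum.cong step) simp_all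
  also have "(\<Sum>s\<le>n. t s + (u (Suc s) - u s)) = shanks_sum x n + (u (Suc n) - u 0)"
    using sum_lessThan_telescope[of u "Suc n"]
    by (simp add: sum.distrib lessThan_Suc_atMost shanks_sum_def t_def)
  also have "u 0 = 0" by (simp add: u_def)
  also have "u (Suc n) = (-1) ^ Suc n * x ^ (n + Suc n + (n * n + n * (n + 1) div 2))"
    by (simp add: u_def t_def power_add mult_ac)
  also have "n + Suc n + (n * n + n * (n + 1) div 2) = Suc n * (3 * Suc n - 1) div 2"
  proof -
    have "Suc n * (3 * Suc n - 1) = n * (n + 1) + 2 * (n + Suc n + n * n)" by (simp add: algebra_simps)
    then show ?thesis by simp
  qed
  also have "Suc n * Suc n + Suc n * (Suc n + 1) div 2 = Suc n * (3 * Suc n + 1) div 2"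
  proof -
    have "Suc n * (3 * Suc n + 1) = Suc n * (Suc n + 1) + 2 * (Suc n * Suc n)" by (simp add: algebra_simps)
    then show ?thesis by simp
  qed
  finally show ?thesis by (simp add: algebra_simps)
qed

text \<open>The generalised pentagonal numbers; they are nonnegative for every integer
  \<open>k\<close>, so \<open>nat\<close> is harmless.\<close>

definition pent :: "int \<Rightarrow> nat" where "pent k = nat (k * (3 * k + 1) div 2)"

lemma shanks_sum_eq:
  "shanks_sum x n = (\<Sum>k\<in>{-int n..int n}. (-1) ^ nat \<bar>k\<bar> * x ^ pent k)"
proof (induction n)
  case 0
  show ?case by (simp add: shanks_sum_def pent_def)
next
  case (Suc n)
  have "{-int (Suc n)..int (Suc n)} = insert (int (Suc n)) (insert (- int (Suc n)) {-int n..int n})" by auto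
  moreover have "pent (int (Suc n)) = Suc n * (3 * Suc n + 1) div 2"
  proof -
    have "int (Suc n) * (3 * int (Suc n) + 1) div 2 = int (Suc n * (3 * Suc n + 1) div 2)"
      unfolding zdiv_int by (rule arg_cong2[where f = "(div)"]) (simp_all add: algebra_simps)
    then show ?thesis unfolding pent_def by simp
  qed
  moreover have "pent (- int (Suc n)) = Suc n * (3 * Suc n - 1) div 2"
  proof -
    have "- int (Suc n) * (3 * - int (Suc n) + 1) div 2 = int (Suc n * (3 * Suc n - 1) div 2)"
      unfolding zdiv_int by (rule arg_cong2[where f = "(div)"]) (simp_all add: algebra_simps)
    then show ?thesis unfolding pent_def by simp
  qed
  ultimately show ?case
    unfolding shanks_sum_Suc Suc.IH by (simp add: algebra_simps del: power_Suc of_nat_Suc) 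
qed

text \<open>Completing the square turns pentagonal exponents into squares of numbers congruent to 1
  modulo 6.\<close>

lemma pent_eq: "24 * int (pent k) + 1 = (6 * k + 1)\<^sup>2"
proof -
  have "even (k * (3 * k + 1))" by simp
  then obtain l where l: "k * (3 * k + 1) = 2 * l" by (rule evenE)
  have "k * (3 * k + 1) \<ge> 0"
    by (cases "k \<ge> 0") (auto intro: mult_nonneg_nonneg mult_nonpos_nonpos)
  with l have "int (pent k) = l" by (simp add: pent_def)
  then have "24 * int (pent k) + 1 = 12 * (k * (3 * k + 1)) + 1" by (simp add: l)
  then show ?thesis by (simp add: power2_eq_square algebra_simps)
qed

lemma abs_le_pent: "\<bar>k\<bar> \<le> int (pent k)"
proof -
  have "24 * int (pent k) = 36 * k\<^sup>2 + 12 * k"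
    using pent_eq[of k] by (simp add: power2_eq_square algebra_simps)
  then show ?thesis using abs_le_power2[of k] by linarith
qed

lemma finite_pent: "finite {k. 6 * pent k = n}"
proof (rule finite_subset)
  show "{k. 6 * pent k = n} \<subseteq> {- int n..int n}"
  proof
    fix k assume "k \<in> {k. 6 * pent k = n}"
    then show "k \<in> {- int n..int n}" using abs_le_pent[of k] by auto
  qed
qed auto

definition pent_fps :: "int fps" where
  "pent_fps = gen_fps (\<lambda>k. 6 * pent k) (\<lambda>k. (-1) ^ nat \<bar>k\<bar>)"

text \<open>By \<open>abs_le_pent\<close>, every \<open>k\<close> contributing to an exponent up to
  n already lies in the summation window.\<close>

lemma shanks_sum_nth_pent:
  assumes "i \<le> n"
  shows "fps_nth (shanks_sum (fps_X ^ 6) n) i = fps_nth pent_fps i"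
proof -
  have "fps_nth (shanks_sum (fps_X ^ 6 :: int fps) n) i
      = (\<Sum>k\<in>{-int n..int n}. fps_nth ((-1) ^ nat \<bar>k\<bar> * fps_X ^ (6 * pent k)) i)"
    by (simp add: shanks_sum_eq fps_sum_nth power_mult)
  also have "\<dots> = (\<Sum>k\<in>{-int n..int n}. if 6 * pent k = i then (-1) ^ nat \<bar>k\<bar> else 0)"
  proof (rule sum.cong[OF refl])
    fix k :: int
    have "(-1) ^ nat \<bar>k\<bar> * (fps_X :: int fps) ^ (6 * pent k) = fps_const ((-1) ^ nat \<bar>k\<bar>) * fps_X ^ (6 * pent k)"
      by (cases "even (nat \<bar>k\<bar>)") auto
    then show "fps_nth ((-1) ^ nat \<bar>k\<bar> * fps_X ^ (6 * pent k)) i = (if 6 * pent k = i then (-1) ^ nat \<bar>k\<bar> else 0 :: int)"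
      by (simp only: fps_mult_left_const_nth fps_X_power_nth) auto
  qed
  also have "\<dots> = (\<Sum>k | k \<in> {-int n..int n} \<and> 6 * pent k = i. (-1) ^ nat \<bar>k\<bar>)"
    by (rule sum.inter_filter[symmetric]) simp
  also have "{k. k \<in> {-int n..int n} \<and> 6 * pent k = i} = {k. 6 * pent k = i}"
  proof safe
    fix k assume "i = 6 * pent k"
    then show "k \<in> {-int n..int n}" using abs_le_pent[of k] assms by auto
  qed
  finally show ?thesis by (simp add: pent_fps_def gen_fps_def)
qed

lemma shanks_sum_nth_prod:
  assumes "i \<le> n"
  shows "fps_nth (shanks_sum (fps_X ^ 6) n) i
       = fps_nth (\<Prod>k<n. 1 - fps_X ^ (6 * Suc k) :: int fps) i"
proof -
  let ?t = "\<lambda>s. (-1) ^ s * (\<Prod>j\<in>{s<..n}. 1 - (fps_X ^ 6) ^ j) * (fps_X ^ 6) ^ (s * n + s * (s + 1) div 2) :: int fps"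
  have "fps_nth (?t s) i = 0" if "s \<noteq> 0" for s
  proof -
    have "1 * n \<le> s * n" "s * (s + 1) div 2 > 0"
      using that by (intro mult_right_mono, simp_all add: div_greater_zero_iff) (cases s, auto)
    moreover have "i < 6 * (u + v)" if "1 * n \<le> u" "v > 0" for u v
      using that assms by simp
    ultimately have "i < 6 * (s * n + s * (s + 1) div 2)" by blast
    then show ?thesis by (simp only: power_mult[symmetric] fps_X_power_mult_right_nth) simp
  qed
  then have "fps_nth (shanks_sum (fps_X ^ 6) n) i = (\<Sum>s\<le>n. if s = 0 then fps_nth (?t 0) i else 0)"
    unfolding shanks_sum_def fps_sum_nth by (intro sum.cong) auto
  also have "\<dots> = fps_nth (\<Prod>j\<in>{0<..n}. 1 - (fps_X ^ 6) ^ j) i" by simp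
  also have "(\<Prod>j\<in>{0<..n}. 1 - (fps_X ^ 6) ^ j) = (\<Prod>k<n. 1 - fps_X ^ (6 * Suc k) :: int fps)"
    by (rule prod.reindex_bij_witness[of _ Suc "\<lambda>j. j - 1"]) (auto simp: power_mult)
  finally show ?thesis .
qed

lemma fps_power_nth_cong:
  fixes f g :: "'a::comm_ring_1 fps"
  assumes "\<And>i. i \<le> n \<Longrightarrow> fps_nth f i = fps_nth g i"
  shows "i \<le> n \<Longrightarrow> fps_nth (f ^ k) i = fps_nth (g ^ k) i"
proof (induction k arbitrary: i)
  case (Suc k)
  show ?case unfolding power_Suc fps_mult_nth
    by (intro sum.cong refl arg_cong2[where f = "(*)"] Suc.IH assms) (use Suc.prems in auto)
qed simp

text \<open>Each coefficient of the partial products is eventually constant and equals that of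
  \<open>pent_fps ^ 4\<close>, which is convergence in the q-adic topology.\<close>

lemma prodinf_eta: "(\<Prod>k. (1 - fps_X ^ (6 * Suc k)) ^ 4) = pent_fps ^ 4"
proof -
  let ?f = "\<lambda>k. 1 - fps_X ^ (6 * Suc k) :: int fps"
  have eq: "fps_nth (\<Prod>k<n. ?f k) i = fps_nth pent_fps i" if "i \<le> n" for n i
    using shanks_sum_nth_prod[OF that] shanks_sum_nth_pent[OF that] by simp
  have "fps_nth (\<Prod>k\<le>K. ?f k ^ 4) n = fps_nth (pent_fps ^ 4) n" if "n \<le> K" for n K
    unfolding prod_power_distrib[symmetric] lessThan_Suc_atMost[symmetric]
    by (rule fps_power_nth_cong[where n = n], rule eq) (use that in simp_all)
  then have "(\<lambda>K. \<Prod>k\<le>K. ?f k ^ 4) \<longlonglongrightarrow> pent_fps ^ 4"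
    unfolding tendsto_fps_iff eventually_sequentially by blast
  \<comment> \<open>\<open>raw_has_prod\<close> requires a nonzero limit; the constant term here is
    1.\<close>
  moreover have "pent_fps ^ 4 \<noteq> 0" using eq[of 0 0] by auto
  ultimately have "(\<lambda>k. ?f k ^ 4) has_prod (pent_fps ^ 4)"
    by (simp add: has_prod_def raw_has_prod_def)
  then show ?thesis by (rule has_prod_unique[symmetric])
qed

section \<open>Four squares by residue class and the coefficients of the eta product\<close>

text \<open>The parameter \<open>c\<close> selects the product E^4 for 1 and E B^3 for 3. The
  cardinalities of \<open>reps 1 0 m\<close> and \<open>reps 1 2 m\<close> are the P and Q of the
  introduction.\<close>

definition reps :: "int \<Rightarrow> int \<Rightarrow> nat \<Rightarrow> (int \<times> int \<times> int \<times> int) set" where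
  "reps c r m = {(x, y, z, w). x mod 6 = 1 \<and> y mod 6 = c \<and> z mod 6 = c \<and> w mod 6 = c \<and>
     x\<^sup>2 + y\<^sup>2 + z\<^sup>2 + w\<^sup>2 = 4 * int m \<and> (x + y + z + w) mod 4 = r}"

lemma finite_sum_squares: "finite {(x, y, z, w). x\<^sup>2 + y\<^sup>2 + z\<^sup>2 + w\<^sup>2 = (n :: int)}"
proof (rule finite_subset)
  show "{(x, y, z, w). x\<^sup>2 + y\<^sup>2 + z\<^sup>2 + w\<^sup>2 = n} \<subseteq> {-n..n} \<times> {-n..n} \<times> {-n..n} \<times> {-n..n}"
  proof safe
    fix x y z w :: int
    show "x \<in> {-(x\<^sup>2 + y\<^sup>2 + z\<^sup>2 + w\<^sup>2)..x\<^sup>2 + y\<^sup>2 + z\<^sup>2 + w\<^sup>2}"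
      "y \<in> {-(x\<^sup>2 + y\<^sup>2 + z\<^sup>2 + w\<^sup>2)..x\<^sup>2 + y\<^sup>2 + z\<^sup>2 + w\<^sup>2}"
      "z \<in> {-(x\<^sup>2 + y\<^sup>2 + z\<^sup>2 + w\<^sup>2)..x\<^sup>2 + y\<^sup>2 + z\<^sup>2 + w\<^sup>2}"
      "w \<in> {-(x\<^sup>2 + y\<^sup>2 + z\<^sup>2 + w\<^sup>2)..x\<^sup>2 + y\<^sup>2 + z\<^sup>2 + w\<^sup>2}"
      using abs_le_power2[of x] abs_le_power2[of y] abs_le_power2[of z] abs_le_power2[of w]
      unfolding atLeastAtMost_iff by linarith+
  qed
qed auto

lemma finite_reps: "finite (reps c r m)"
  by (rule finite_subset[OF _ finite_sum_squares[of "4 * int m"]]) (auto simp: reps_def)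

text \<open>The map k to 6 k + 1 matches pentagonal indices with the class 1 modulo 6. Four such
  values add up to 6 K + 4, with K the sum of the indices, which is 0 modulo 4 exactly when K is
  even, that is, when the product of the signs is 1.\<close>

lemma eta_coeff_eq_card_reps:
  assumes "m > 0"
  shows "eta_coeff m = int (card (reps 1 0 m)) - int (card (reps 1 2 m))"
proof -
  let ?s = "\<lambda>k::int. (-1) ^ nat \<bar>k\<bar> :: int"
  let ?S = "{(x, y, z, w). 6 * pent x + 6 * pent y + 6 * pent z + 6 * pent w = m - 1}"
  let ?j = "\<lambda>(x, y, z, w). (6 * x + 1, 6 * y + 1, 6 * z + 1, 6 * w + 1) :: int \<times> int \<times> int \<times> int"
  let ?i = "\<lambda>(x, y, z, w). (x div 6, y div 6, z div 6, w div 6) :: int \<times> int \<times> int \<times> int"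
  let ?c = "\<lambda>(x, y, z, w). if (x + y + z + w) mod 4 = 0 then 1 else -1 :: int"
  have "eta_coeff m = fps_nth (pent_fps ^ 4) (m - 1)"
    using assms unfolding eta_coeff_def fps_X_mult_nth prodinf_eta by simp
  also have "pent_fps ^ 4 = pent_fps * pent_fps * pent_fps * pent_fps"
    by (simp add: eval_nat_numeral mult.assoc)
  also have "fps_nth \<dots> (m - 1) = (\<Sum>(x, y, z, w)\<in>?S. ?s x * ?s y * ?s z * ?s w)"
    unfolding pent_fps_def by (rule gen_fps_mult4[OF finite_pent])
  also have "\<dots> = sum ?c (reps 1 0 m \<union> reps 1 2 m)"
  proof (rule sum.reindex_bij_witness[of _ ?i ?j])
    fix p assume p: "p \<in> ?S"
    obtain x y z w where [simp]: "p = (x, y, z, w)" by (cases p)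
    show "?i (?j p) = p" by simp
    have s: "?s k = (if even k then 1 else -1)" for k
      by (simp add: even_nat_iff minus_one_power_iff)
    have sum: "6 * x + 1 + (6 * y + 1) + (6 * z + 1) + (6 * w + 1) = 6 * (x + y + z + w) + 4" by simp
    have "(6 * k + 4) mod 4 = (if even k then 0 else 2)" for k :: int by presburger
    note par = this[of "x + y + z + w"]
    from p have "6 * pent x + 6 * pent y + 6 * pent z + 6 * pent w + 1 = m" using assms by auto
    then have "6 * int (pent x) + 6 * int (pent y) + 6 * int (pent z) + 6 * int (pent w) + 1 = int m"
      by linarith
    then have "(6 * x + 1)\<^sup>2 + (6 * y + 1)\<^sup>2 + (6 * z + 1)\<^sup>2 + (6 * w + 1)\<^sup>2 = 4 * int m"
      unfolding pent_eq[symmetric] by linarith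
    then show "?j p \<in> reps 1 0 m \<union> reps 1 2 m"
      unfolding reps_def prod.case Un_iff mem_Collect_eq sum par \<open>p = (x, y, z, w)\<close>
      by (simp add: mod_simps)
    show "?c (?j p) = (case p of (x, y, z, w) \<Rightarrow> ?s x * ?s y * ?s z * ?s w)"
      unfolding \<open>p = (x, y, z, w)\<close> prod.case sum par s by simp
  next
    fix p assume p: "p \<in> reps 1 0 m \<union> reps 1 2 m"
    obtain x y z w where p_eq[simp]: "p = (x, y, z, w)" by (cases p)
    have m1: "x mod 6 = 1" "y mod 6 = 1" "z mod 6 = 1" "w mod 6 = 1"
      and sq: "x\<^sup>2 + y\<^sup>2 + z\<^sup>2 + w\<^sup>2 = 4 * int m" using p by (auto simp: reps_def)
    have d: "6 * (k div 6) + 1 = k" if "k mod 6 = 1" for k :: int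
      using div_mult_mod_eq[of k 6] that by simp
    then show "?j (?i p) = p" using m1 by simp
    have "int (6 * pent (x div 6) + 6 * pent (y div 6) + 6 * pent (z div 6) + 6 * pent (w div 6)) = int (m - 1)"
      using sq pent_eq[of "x div 6"] pent_eq[of "y div 6"] pent_eq[of "z div 6"] pent_eq[of "w div 6"] assms
      by (simp add: d m1 of_nat_diff)
    then have "6 * pent (x div 6) + 6 * pent (y div 6) + 6 * pent (z div 6) + 6 * pent (w div 6) = m - 1"
      by (simp only: of_nat_eq_iff)
    then show "?i p \<in> ?S" by simp
  qed
  also have "\<dots> = sum ?c (reps 1 0 m) + sum ?c (reps 1 2 m)"
    by (rule sum.union_disjoint) (auto simp: finite_reps, auto simp: reps_def)
  also have "sum ?c (reps 1 0 m) = (\<Sum>_\<in>reps 1 0 m. 1)"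
    by (intro sum.cong) (auto simp: reps_def)
  also have "sum ?c (reps 1 2 m) = (\<Sum>_\<in>reps 1 2 m. -1)"
    by (intro sum.cong) (auto simp: reps_def)
  finally show ?thesis by simp
qed

subsection \<open>The Hadamard involution\<close>

definition mod6 :: "int \<Rightarrow> int set" where "mod6 r = {x. x mod 6 = r}"

text \<open>\<open>- 1/2\<close> times the symmetric Hadamard matrix of order \<open>4\<close>, hence an orthogonal involution.\<close>
definition hadamard :: "int \<times> int \<times> int \<times> int \<Rightarrow> int \<times> int \<times> int \<times> int" where
  "hadamard = (\<lambda>(x, y, z, w). let s = (x + y + z + w) div 2 in (- s, z + w - s, y + w - s, y + z - s))"

text \<open>The coordinate sum is 4 modulo 6 for both values of \<open>c\<close>, and 2 modulo 4, so
  its half \<open>s\<close> is 5 modulo 6. Hence \<open>- s\<close> is 1 and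
  \<open>z + w - s\<close> is 2 c + 1 modulo 6, which is 3 for c = 1 and 1 for c = 3. The new sum
  \<open>- 2 * x\<close> is again 2 modulo 4.\<close>

lemma hadamard_components:
  assumes mod6: "x mod 6 = 1" "y mod 6 = c" "z mod 6 = c" "w mod 6 = c" and c: "c = 1 \<or> c = 3"
    and sum: "(x + y + z + w) mod 4 = 2"
  shows "\<exists>x' y' z' w'. hadamard (x, y, z, w) = (x', y', z', w') \<and> hadamard (x', y', z', w') = (x, y, z, w) \<and>
     x' mod 6 = 1 \<and> y' mod 6 = 4 - c \<and> z' mod 6 = 4 - c \<and> w' mod 6 = 4 - c \<and>
     x'\<^sup>2 + y'\<^sup>2 + z'\<^sup>2 + w'\<^sup>2 = x\<^sup>2 + y\<^sup>2 + z\<^sup>2 + w\<^sup>2 \<and> (x' + y' + z' + w') mod 4 = 2"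
proof -
  define s where "s = (x + y + z + w) div 2"
  have "even (x + y + z + w)" using sum by presburger
  then have x: "x = 2 * s - y - z - w" unfolding s_def by simp
  obtain a where a: "x = 6 * a + 1" using mod6(1) div_mult_mod_eq[of x 6] by (metis mult.commute)
  obtain b1 where y: "y = 6 * b1 + c" using mod6(2) div_mult_mod_eq[of y 6] by (metis mult.commute)
  obtain b2 where z: "z = 6 * b2 + c" using mod6(3) div_mult_mod_eq[of z 6] by (metis mult.commute)
  obtain b3 where w: "w = 6 * b3 + c" using mod6(4) div_mult_mod_eq[of w 6] by (metis mult.commute)
  have s6: "s mod 6 = 5"
  proof -
    have *: "t div 2 mod 6 = 5" if "t mod 4 = 2" "t = 6 * k + 4" for t k :: int
      using that by presburger
    \<comment> \<open>The \<open>if\<close> absorbs the carry in 1 + 3 c, which is 4 or 10.\<close>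
    have "x + y + z + w = 6 * (a + b1 + b2 + b3 + (if c = 1 then 0 else 1)) + 4"
      using c by (auto simp: a y z w)
    then show ?thesis unfolding s_def by (intro *[OF sum])
  qed
  then obtain t where t: "s = 6 * t + 5" using div_mult_mod_eq[of s 6] by (metis mult.commute)
  have h: "hadamard (x, y, z, w) = (- s, z + w - s, y + w - s, y + z - s)"
    by (simp add: hadamard_def s_def Let_def)
  have S: "- s + (z + w - s) + (y + w - s) + (y + z - s) = 2 * (- x)"
    by (simp add: x)
  have inv: "hadamard (- s, z + w - s, y + w - s, y + z - s) = (x, y, z, w)"
    unfolding hadamard_def prod.case S Let_def by (simp add: x)
  have n1: "(- s) mod 6 = 1" unfolding t by presburger
  have n2: "(p + q - s) mod 6 = 4 - c" if "p = 6 * p' + c" "q = 6 * q' + c" for p q p' q'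
  proof -
    have "p + q - s = 6 * (p' + q' - t - 1 + (if c = 1 then 0 else 1)) + (4 - c)"
      using c by (auto simp: that t)
    then show ?thesis using c by (simp only: mod_mult_self4) auto
  qed
  have n3: "(- s)\<^sup>2 + (z + w - s)\<^sup>2 + (y + w - s)\<^sup>2 + (y + z - s)\<^sup>2 = x\<^sup>2 + y\<^sup>2 + z\<^sup>2 + w\<^sup>2"
    unfolding x by algebra
  have n4: "(2 * (- x)) mod 4 = 2" unfolding a by presburger
  show ?thesis
    by (intro exI conjI) (rule h inv n1 n2[OF z w] n2[OF y w] n2[OF y z] n3 n4[folded S])+
qed

lemma hadamard_reps:
  assumes c: "c = 1 \<or> c = 3" and p: "p \<in> reps c 2 m"
  shows "hadamard (hadamard p) = p \<and> hadamard p \<in> reps (4 - c) 2 m"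
proof -
  obtain x y z w where eq: "p = (x, y, z, w)" by (cases p)
  have *: "x mod 6 = 1" "y mod 6 = c" "z mod 6 = c" "w mod 6 = c" "(x + y + z + w) mod 4 = 2"
    and sq: "x\<^sup>2 + y\<^sup>2 + z\<^sup>2 + w\<^sup>2 = 4 * int m"
    using p by (simp_all add: eq reps_def)
  show ?thesis
    using hadamard_components[OF *(1-4) c *(5)] unfolding eq sq by (elim exE) (simp add: reps_def)
qed

lemma card_reps_1_eq_reps_3: "card (reps 1 2 m) = card (reps 3 2 m)"
  by (rule bij_betw_same_card[of hadamard], rule bij_betw_byWitness[where f' = hadamard])
     (use hadamard_reps[of 1 _ m] hadamard_reps[of 3 _ m] in auto)

text \<open>Negating \<open>w\<close> preserves the class 3 modulo 6 and changes the sum by 2 w,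
  which is 2 modulo 4. With \<open>card_reps_1_eq_reps_3\<close> this makes the coefficient of E B^3
  equal to 2 Q.\<close>

lemma card_reps_3_parity: "card (reps 3 0 m) = card (reps 3 2 m)"
proof -
  define f where "f = (\<lambda>(x, y, z, w). (x, y, z, - w) :: int \<times> int \<times> int \<times> int)"
  have w: "(- w) mod 6 = 3" if "w mod 6 = 3" for w :: int using that by presburger
  have s: "((u + w) mod 4 = 0 \<longrightarrow> (u - w) mod 4 = 2) \<and> ((u + w) mod 4 = 2 \<longrightarrow> (u - w) mod 4 = 0)"
    if "w mod 6 = 3" for u w :: int
  proof -
    define k where "k = w div 6"
    have "w = 6 * k + 3" using that div_mult_mod_eq[of w 6] by (simp add: k_def)
    moreover have "((u + (6 * k + 3)) mod 4 = 0 \<longrightarrow> (u - (6 * k + 3)) mod 4 = 2) \<and>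
        ((u + (6 * k + 3)) mod 4 = 2 \<longrightarrow> (u - (6 * k + 3)) mod 4 = 0)" by presburger
    ultimately show ?thesis by simp
  qed
  have "f ` reps 3 0 m \<subseteq> reps 3 2 m" "f ` reps 3 2 m \<subseteq> reps 3 0 m"
    by (auto simp: f_def reps_def w s)
  then have "bij_betw f (reps 3 0 m) (reps 3 2 m)"
    by (intro bij_betw_byWitness[where f' = f]) (auto simp: f_def)
  then show ?thesis by (rule bij_betw_same_card)
qed

lemma sum_odd_mod_4:
  fixes x y z w :: int
  assumes "odd x" "odd y" "odd z" "odd w"
  shows "(x + y + z + w) mod 4 = 0 \<or> (x + y + z + w) mod 4 = 2"
proof -
  have "t mod 4 = 0 \<or> t mod 4 = 2" if "even t" for t :: int using that by presburger
  then show ?thesis using assms by simp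
qed

lemma theta_reps:
  assumes "odd c"
  shows "fps_nth (theta (mod6 1) * theta (mod6 c) * theta (mod6 c) * theta (mod6 c)) (4 * m)
       = int (card (reps c 0 m)) + int (card (reps c 2 m))"
proof -
  have odd: "odd x" if "x mod 6 = d" "odd d" for x d :: int using that by presburger
  have "(x + y + z + w) mod 4 = 0 \<or> (x + y + z + w) mod 4 = 2"
    if "x mod 6 = 1" "y mod 6 = c" "z mod 6 = c" "w mod 6 = c" for x y z w
    by (rule sum_odd_mod_4[OF odd[OF that(1) odd_one] odd[OF that(2) assms] odd[OF that(3) assms] odd[OF that(4) assms]])
  then have "{(x, y, z, w). x \<in> mod6 1 \<and> y \<in> mod6 c \<and> z \<in> mod6 c \<and> w \<in> mod6 c \<and>
      x\<^sup>2 + y\<^sup>2 + z\<^sup>2 + w\<^sup>2 = int (4 * m)} = reps c 0 m \<union> reps c 2 m"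
    unfolding mod6_def reps_def of_nat_mult of_nat_numeral by blast
  moreover have "card (reps c 0 m \<union> reps c 2 m) = card (reps c 0 m) + card (reps c 2 m)"
    by (rule card_Un_disjoint) (auto simp: finite_reps, auto simp: reps_def)
  ultimately show ?thesis by (simp add: theta_mult4)
qed

subsection \<open>Three-dissection\<close>

text \<open>Residues are compared modulo 3 on both sides, so that \<open>r\<close> may simply be
  added up in products.\<close>

definition supp3 :: "nat \<Rightarrow> int fps \<Rightarrow> bool" where
  "supp3 r f \<longleftrightarrow> (\<forall>n. fps_nth f n \<noteq> 0 \<longrightarrow> n mod 3 = r mod 3)"

lemma supp3_mult: "supp3 r f \<Longrightarrow> supp3 s g \<Longrightarrow> supp3 (r + s) (f * g)"
  unfolding supp3_def
proof safe
  fix n assume *: "\<forall>n. fps_nth f n \<noteq> 0 \<longrightarrow> n mod 3 = r mod 3" "\<forall>n. fps_nth g n \<noteq> 0 \<longrightarrow> n mod 3 = s mod 3"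
    and "fps_nth (f * g) n \<noteq> 0"
  then obtain i where i: "i \<le> n" "fps_nth f i * fps_nth g (n - i) \<noteq> 0"
    unfolding fps_mult_nth by (metis (no_types, lifting) atLeastAtMost_iff sum.neutral)
  with * have "i mod 3 = r mod 3" "(n - i) mod 3 = s mod 3" by auto
  then have "(i + (n - i)) mod 3 = (r + s) mod 3" by (rule mod_add_cong)
  with i show "n mod 3 = (r + s) mod 3" by simp
qed

lemma supp3_theta:
  assumes "\<And>x. x \<in> S \<Longrightarrow> x\<^sup>2 mod 3 = int r"
  shows "supp3 r (theta S)"
  unfolding supp3_def
proof safe
  fix n assume "fps_nth (theta S) n \<noteq> 0"
  then have "{x \<in> S. x\<^sup>2 = int n} \<noteq> {}" by (metis theta_nth card.empty of_nat_0)
  then obtain x where "x \<in> S" "x\<^sup>2 = int n" by auto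
  with assms have "int n mod 3 = int r" by metis
  then have "int (n mod 3) = int r" by (simp add: zmod_int)
  then have "n mod 3 = r" by (simp only: of_nat_eq_iff)
  then show "n mod 3 = r mod 3" by auto
qed

lemma supp3_mod6_1: "supp3 1 (theta (mod6 1))"
proof (rule supp3_theta)
  fix x assume "x \<in> mod6 1"
  then have "x mod 6 = 1" by (simp add: mod6_def)
  then have "x mod 3 = 1" by presburger
  then show "x\<^sup>2 mod 3 = int 1" by (simp add: power_mod[symmetric])
qed

lemma supp3_mod6_3: "supp3 0 (theta (mod6 3))"
proof (rule supp3_theta)
  fix x assume "x \<in> mod6 3"
  then have "x mod 6 = 3" by (simp add: mod6_def)
  then have "x mod 3 = 0" by presburger
  then show "x\<^sup>2 mod 3 = int 0" by (simp add: power_mod[symmetric])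
qed

text \<open>The class 5 modulo 6 is the negative of the class 1 and has the same squares.\<close>

lemma theta_odds_eq: "theta odds = 2 * theta (mod6 1) + theta (mod6 3)"
proof -
  have mod: "x mod 6 = 5 \<longleftrightarrow> (- x) mod 6 = 1" for x :: int by presburger
  have "x \<in> uminus ` mod6 1 \<longleftrightarrow> - x \<in> mod6 1" for x by force
  then have 5: "mod6 5 = uminus ` mod6 1" by (intro set_eqI) (simp add: mod6_def mod)
  have "odd x \<longleftrightarrow> x mod 6 = 1 \<or> x mod 6 = 5 \<or> x mod 6 = 3" for x :: int by presburger
  then have o: "odds = (mod6 1 \<union> mod6 5) \<union> mod6 3"
    unfolding odds_def mod6_def by (intro set_eqI) simp
  have d1: "mod6 1 \<inter> mod6 5 = {}" and d2: "(mod6 1 \<union> mod6 5) \<inter> mod6 3 = {}"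
    by (auto simp: mod6_def)
  have "theta odds = theta (mod6 1) + theta (mod6 5) + theta (mod6 3)"
    unfolding o theta_Un[OF d2] theta_Un[OF d1] ..
  then show ?thesis by (simp add: 5 theta_uminus)
qed

text \<open>Multiplying by 8 and adding 1 + 1 + 9 + 9 gives 8 n + 20 on the left and four squares on
  the right.\<close>

lemma tri_count_eq_theta:
  "int (tri_count 1 1 9 9 n)
   = fps_nth (theta odds * theta odds * theta (mod6 3) * theta (mod6 3)) (4 * (2 * n + 5))"
proof -
  let ?T = "{(x, y, z, w). x \<in> odds \<and> y \<in> odds \<and> z \<in> mod6 3 \<and> w \<in> mod6 3 \<and>
      x\<^sup>2 + y\<^sup>2 + z\<^sup>2 + w\<^sup>2 = int (4 * (2 * n + 5))}"
  let ?j = "\<lambda>(x, y, z, w). (2 * x - 1, 2 * y - 1, 6 * z - 3, 6 * w - 3) :: int \<times> int \<times> int \<times> int"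
  let ?i = "\<lambda>(x, y, z, w). ((x + 1) div 2, (y + 1) div 2, (z + 3) div 6, (w + 3) div 6) :: int \<times> int \<times> int \<times> int"
  have tri: "(2 * x - 1)\<^sup>2 = 8 * (x * (x - 1) div 2) + 1" for x :: int
  proof -
    have "even (x * (x - 1))" by simp
    then have "8 * (x * (x - 1) div 2) = 4 * (x * (x - 1))" by simp
    then show ?thesis by (simp add: power2_eq_square algebra_simps)
  qed
  have tri3: "(6 * x - 3)\<^sup>2 = 72 * (x * (x - 1) div 2) + 9" for x :: int
    using tri[of x] by (simp add: power2_eq_square algebra_simps)
  have mem: "(x, y, z, w) \<in> tri_reps 1 1 9 9 n \<longleftrightarrow>
      (2 * x - 1)\<^sup>2 + (2 * y - 1)\<^sup>2 + (6 * z - 3)\<^sup>2 + (6 * w - 3)\<^sup>2 = int (4 * (2 * n + 5))" for x y z w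
    unfolding tri tri3 tri_reps_def by auto
  have m6: "(6 * z - 3) mod 6 = 3" for z :: int by presburger
  have odd_eq: "2 * ((x + 1) div 2) - 1 = x" if "x \<in> odds" for x
  proof -
    have "2 * ((x + 1) div 2) - 1 = x" if "odd x" for x :: int using that by presburger
    with that show ?thesis by (simp add: odds_def)
  qed
  have mod6_eq: "6 * ((z + 3) div 6) - 3 = z" if "z \<in> mod6 3" for z
  proof -
    have "6 * ((z + 3) div 6) - 3 = z" if "z mod 6 = 3" for z :: int using that by presburger
    with that show ?thesis by (simp add: mod6_def)
  qed
  have bij: "bij_betw ?j (tri_reps 1 1 9 9 n) ?T"
  proof (rule bij_betw_byWitness[where f' = ?i])
    show "\<forall>p\<in>tri_reps 1 1 9 9 n. ?i (?j p) = p" by auto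
    show "\<forall>p\<in>?T. ?j (?i p) = p" by (auto simp: odd_eq mod6_eq)
    show "?j ` tri_reps 1 1 9 9 n \<subseteq> ?T" by (auto simp: mem[simplified] odds_def mod6_def m6)
    show "?i ` ?T \<subseteq> tri_reps 1 1 9 9 n" by (auto simp: mem[simplified] odd_eq mod6_eq)
  qed
  show ?thesis unfolding theta_mult4 tri_count_def bij_betw_same_card[OF bij] ..
qed

lemma mod6_3_iff: "x \<in> mod6 3 \<longleftrightarrow> (\<exists>y. x = 3 * y \<and> y \<in> odds)"
proof
  assume "x \<in> mod6 3"
  then have "x mod 6 = 3" by (simp add: mod6_def)
  then have "x = 3 * (x div 3) \<and> odd (x div 3)" by presburger
  then show "\<exists>y. x = 3 * y \<and> y \<in> odds" by (auto simp: odds_def)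
next
  assume "\<exists>y. x = 3 * y \<and> y \<in> odds"
  moreover have "odd y \<Longrightarrow> (3 * y) mod 6 = 3" for y :: int by presburger
  ultimately show "x \<in> mod6 3" by (auto simp: mod6_def odds_def)
qed

text \<open>The elements of \<open>mod6 3\<close> are the triples of odd numbers, so all exponents
  are multiplied by 9.\<close>

lemma theta_mod6_3_power4:
  "fps_nth (theta (mod6 3) ^ 4) n = (if 9 dvd n then fps_nth (theta odds ^ 4) (n div 9) else 0)"
proof -
  let ?S = "{(x, y, z, w). x \<in> mod6 3 \<and> y \<in> mod6 3 \<and> z \<in> mod6 3 \<and> w \<in> mod6 3 \<and>
      x\<^sup>2 + y\<^sup>2 + z\<^sup>2 + w\<^sup>2 = int n}"
  let ?T = "\<lambda>k. {(x, y, z, w). x \<in> odds \<and> y \<in> odds \<and> z \<in> odds \<and> w \<in> odds \<and>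
      x\<^sup>2 + y\<^sup>2 + z\<^sup>2 + w\<^sup>2 = int k}"
  have sq: "(3 * x)\<^sup>2 + (3 * y)\<^sup>2 + (3 * z)\<^sup>2 + (3 * w)\<^sup>2 = 9 * (x\<^sup>2 + y\<^sup>2 + z\<^sup>2 + w\<^sup>2)" for x y z w :: int
    by (simp add: power_mult_distrib)
  show ?thesis
  proof (cases "9 dvd n")
    case True
    then obtain k where n: "n = 9 * k" by (rule dvdE)
    have "?S = (\<lambda>(x, y, z, w). (3 * x, 3 * y, 3 * z, 3 * w)) ` ?T k"
      using sq by (auto simp: mod6_3_iff n image_iff)
    moreover have "inj_on (\<lambda>(x, y, z, w). (3 * x, 3 * y, 3 * z, 3 * w) :: int \<times> int \<times> int \<times> int) (?T k)"
      by (auto simp: inj_on_def)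
    ultimately have "card ?S = card (?T k)" by (simp only: card_image)
    then show ?thesis unfolding power4_eq_xxxx theta_mult4 by (simp add: n)
  next
    case False
    have "\<not> 9 dvd int n" using False by (metis int_dvd_int_iff of_nat_numeral)
    have "p \<notin> ?S" for p
    proof
      assume "p \<in> ?S"
      then obtain x y z w where "(3 * x)\<^sup>2 + (3 * y)\<^sup>2 + (3 * z)\<^sup>2 + (3 * w)\<^sup>2 = int n"
        by (auto simp: mod6_3_iff simp del: power_mult_distrib)
      then have "9 dvd int n" unfolding sq by (metis dvd_triv_left)
      with \<open>\<not> 9 dvd int n\<close> show False ..
    qed
    then have "?S = {}" by blast
    then show ?thesis unfolding power4_eq_xxxx theta_mult4 by (simp only: card.empty False if_False of_nat_0)
  qed
qed

lemma theta_odds_power4_odd: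
  assumes "odd m"
  shows "fps_nth (theta odds ^ 4) (4 * m) = 16 * int (divisor_sum m)"
proof -
  have "(4 * m) mod 8 = 4" using assms by presburger
  then show ?thesis by (simp add: theta_odds_power4 odd_sigma_def)
qed

section \<open>Comparison of coefficients according to n modulo 3\<close>

theorem theorem4p2:
  fixes n :: nat
  assumes "n > 0"
  shows "(n mod 3 = 0 \<longrightarrow>
           real (tri_count 1 1 9 9 n) = 8 / 3 * real (divisor_sum (2 * n + 5)))
       \<and> (n mod 9 = 2 \<longrightarrow>
           real (tri_count 1 1 9 9 n) = 16 * real (divisor_sum ((2 * n + 5) div 9)))
       \<and> (n mod 9 = 5 \<or> n mod 9 = 8 \<longrightarrow>
           real (tri_count 1 1 9 9 n) = 0)
       \<and> (n mod 3 = 1 \<longrightarrow>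
           real (tri_count 1 1 9 9 n) =
             8 / 3 * (real (divisor_sum (2 * n + 5)) - real_of_int (eta_coeff (2 * n + 5))))"
proof -
  define m where "m = 2 * n + 5"
  define e where "e = theta (mod6 1)"
  define b where "b = theta (mod6 3)"
  define t where "t = int (tri_count 1 1 9 9 n)"
  define s where "s = int (divisor_sum m)"
  define E where "E = (\<lambda>f :: int fps. fps_nth f (4 * m))"
  have supp_e: "supp3 1 e" and supp_b: "supp3 0 b"
    unfolding e_def b_def by (rule supp3_mod6_1 supp3_mod6_3)+
  note supp = supp3_mult[OF supp3_mult[OF supp3_mult]]
  \<comment> \<open>Since 4 m and m agree modulo 3, a monomial contributes only if its number of
    factors \<open>e\<close> is congruent to m.\<close>
  have z: "E f = 0" if "supp3 r f" "m mod 3 \<noteq> r mod 3" for r f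
  proof (rule ccontr)
    assume "E f \<noteq> 0"
    then have "(4 * m) mod 3 = r mod 3" using that(1) unfolding E_def supp3_def by blast
    then show False using that(2) by presburger
  qed
  have o: "theta odds = 2 * e + b" by (simp add: theta_odds_eq e_def b_def)
  have "theta odds ^ 4 = 16 * (e * e * e * e) + 32 * (e * e * e * b) + 24 * (e * e * b * b)
      + 8 * (e * b * b * b) + b * b * b * b"
    unfolding o by algebra
  moreover have "odd m" by (simp add: m_def)
  ultimately have s: "16 * s = 16 * E (e * e * e * e) + 32 * E (e * e * e * b) + 24 * E (e * e * b * b)
      + 8 * E (e * b * b * b) + E (b * b * b * b)"
    using theta_odds_power4_odd[of m] by (simp add: s_def E_def)
  have "theta odds * theta odds * b * b = 4 * (e * e * b * b) + 4 * (e * b * b * b) + b * b * b * b"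
    unfolding o by algebra
  then have t: "t = 4 * E (e * e * b * b) + 4 * E (e * b * b * b) + E (b * b * b * b)"
    using tri_count_eq_theta[of n] by (simp add: t_def b_def[symmetric] m_def[symmetric] E_def)
  note eeee = z[OF supp[OF supp_e supp_e supp_e supp_e]]
  note eeeb = z[OF supp[OF supp_e supp_e supp_e supp_b]]
  note eebb = z[OF supp[OF supp_e supp_e supp_b supp_b]]
  note ebbb = z[OF supp[OF supp_e supp_b supp_b supp_b]]
  note bbbb = z[OF supp[OF supp_b supp_b supp_b supp_b]]
  \<comment> \<open>Only \<open>e * e * b * b\<close> survives: \<open>16 * s\<close> is 24 times
    and \<open>t\<close> is 4 times its coefficient.\<close>
  have 0: "3 * t = 8 * s" if "n mod 3 = 0"
  proof -
    have "m mod 3 = 2" using that unfolding m_def by presburger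
    then show ?thesis using s t eeee eeeb ebbb bbbb by simp
  qed
  \<comment> \<open>Here s = P + 2 Q and c(m) = P - Q, so the difference is 3 Q, while t = 8
    Q.\<close>
  have 1: "3 * t = 8 * (s - eta_coeff m)" if "n mod 3 = 1"
  proof -
    have "m mod 3 = 1" using that unfolding m_def by presburger
    moreover have "E (e * e * e * e) = int (card (reps 1 0 m)) + int (card (reps 1 2 m))"
      "E (e * b * b * b) = 2 * int (card (reps 1 2 m))"
      unfolding E_def e_def b_def
      by (simp_all add: theta_reps card_reps_1_eq_reps_3 card_reps_3_parity)
    moreover have "eta_coeff m = int (card (reps 1 0 m)) - int (card (reps 1 2 m))"
      by (rule eta_coeff_eq_card_reps) (simp add: m_def)
    ultimately show ?thesis using s t eeeb eebb bbbb by simp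
  qed
  have 2: "t = (if 9 dvd m then 16 * int (divisor_sum (m div 9)) else 0)" if "n mod 3 = 2"
  proof -
    have m3: "m mod 3 = 0" using that unfolding m_def by presburger
    \<comment> \<open>The term \<open>e * e * e * b\<close> has residue 0 too, but it does not occur
      in \<open>t\<close>.\<close>
    with t ebbb eebb have "t = E (b ^ 4)" by (simp add: power4_eq_xxxx)
    also have "\<dots> = (if 9 dvd 4 * m then fps_nth (theta odds ^ 4) (4 * m div 9) else 0)"
      by (simp add: E_def b_def theta_mod6_3_power4)
    also have "9 dvd 4 * m \<longleftrightarrow> 9 dvd m" by presburger
    also have "(if 9 dvd m then fps_nth (theta odds ^ 4) (4 * m div 9) else 0)
        = (if 9 dvd m then 16 * int (divisor_sum (m div 9)) else 0)"
    proof (cases "9 dvd m")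
      case True
      then obtain k where "m = 9 * k" by (rule dvdE)
      with \<open>odd m\<close> show ?thesis by (simp add: theta_odds_power4_odd)
    qed simp
    finally show ?thesis .
  qed
  have 3: "9 dvd m \<longleftrightarrow> n mod 9 = 2" unfolding m_def by presburger
  have rt: "real (tri_count 1 1 9 9 n) = real_of_int t" "real (divisor_sum m) = real_of_int s"
    by (simp_all add: t_def s_def)
  show ?thesis
    unfolding m_def[symmetric]
  proof (intro conjI impI)
    assume "n mod 3 = 0"
    from arg_cong[OF 0[OF this], of real_of_int] show "real (tri_count 1 1 9 9 n) = 8 / 3 * real (divisor_sum m)"
      unfolding rt by simp
  next
    assume n: "n mod 9 = 2"
    then have "n mod 3 = 2" by presburger
    from 2[OF this] n 3 show "real (tri_count 1 1 9 9 n) = 16 * real (divisor_sum (m div 9))"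
      unfolding rt by simp
  next
    assume n: "n mod 9 = 5 \<or> n mod 9 = 8"
    then have "n mod 3 = 2" by presburger
    from 2[OF this] n 3 show "real (tri_count 1 1 9 9 n) = 0"
      unfolding rt by auto
  next
    assume "n mod 3 = 1"
    from arg_cong[OF 1[OF this], of real_of_int] show "real (tri_count 1 1 9 9 n)
        = 8 / 3 * (real (divisor_sum m) - real_of_int (eta_coeff m))"
      unfolding rt by simp
  qed
qed

end
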